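(* For any basic sequence $Q$, the set $\mathscr{DN}(Q)$ is of the first category (meager) in $\mathbb R$.
   Context: A basic sequence is a sequence $Q=(q_n)_{n=1}^\infty$ of integers $q_n\ge 2$. With $T_{Q,n}(x)=\left(\prod_{j=1}^n q_j\right)x \pmod 1$, $\mathscr{DN}(Q)$ is the set of real $x$ such that the sequence $(T_{Q,n}(x))_{n=0}^\infty$ is uniformly distributed mod $1$. *)

theory Defs
  imports "HOL-Analysis.Analysis"
begin

text \<open>Basic sequences are indexed from 1, so the value \<open>Q 0\<close> is irrelevant.\<close>

definition basic_sequence :: "(nat \<Rightarrow> int) \<Rightarrow> bool" where
  "basic_sequence Q \<longleftrightarrow> (\<forall>n\<ge>1. Q n \<ge> 2)"

definition T_map :: "(nat \<Rightarrow> int) \<Rightarrow> nat \<Rightarrow> real \<Rightarrow> real" where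
  "T_map Q n x = frac (of_int (\<Prod>j=1..n. Q j) * x)"

definition uniformly_distributed_mod1 :: "(nat \<Rightarrow> real) \<Rightarrow> bool" where
  "uniformly_distributed_mod1 u \<longleftrightarrow>
     (\<forall>a b. 0 \<le> a \<and> a < b \<and> b \<le> 1 \<longrightarrow>
        (\<lambda>N. real (card {n. n < N \<and> frac (u n) \<in> {a..<b}}) / real N) \<longlonglongrightarrow> b - a)"

definition DN :: "(nat \<Rightarrow> int) \<Rightarrow> real set" where
  "DN Q = {x. uniformly_distributed_mod1 (\<lambda>n. T_map Q n x)}"

definition nowhere_dense :: "'a::topological_space set \<Rightarrow> bool" where
  "nowhere_dense A \<longleftrightarrow> interior (closure A) = {}"

definition meager :: "'a::topological_space set \<Rightarrow> bool" where
  "meager S \<longleftrightarrow> (\<exists>\<F>. countable \<F> \<and> (\<forall>A\<in>\<F>. nowhere_dense A) \<and> S = \<Union>\<F>)"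

end

theory Submission
  imports Defs
begin

text \<open>
  If \<open>x\<close> is in \<open>DN Q\<close>, then from some \<open>K\<close> on at most \<open>3N/4\<close> of the first \<open>N\<close> orbit points
  lie in \<open>[0,1/2)\<close>. For fixed \<open>K\<close> the set of such \<open>x\<close> is nowhere dense: the points
  \<open>m / (q\<^sub>1 \<cdots> q\<^sub>n)\<close> are dense, the orbit of such a point is eventually \<open>0\<close>, and so
  every point slightly to its right has an orbit staying in \<open>[0,1/2)\<close> for as long as desired.
\<close>

text \<open>An open set that misses \<open>A\<close> also misses its closure, so no such
  \<open>V\<close> fits inside a nonempty interior of \<open>closure A\<close>.\<close>

lemma nowhere_denseI:
  fixes A :: "'a::topological_space set"
  assumes "\<And>U. open U \<Longrightarrow> U \<noteq> {} \<Longrightarrow> \<exists>V. open V \<and> V \<noteq> {} \<and> V \<subseteq> U \<and> V \<inter> A = {}"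
  shows "nowhere_dense A"
  unfolding nowhere_dense_def
proof (rule ccontr)
  assume "interior (closure A) \<noteq> {}"
  with assms[OF open_interior] obtain V
    where "open V" "V \<noteq> {}" "V \<subseteq> interior (closure A)" "V \<inter> A = {}"
    by blast
  then show False
    using open_Int_closure_eq_empty[of V A] interior_subset[of "closure A"] by blast
qed

lemma nowhere_dense_subset: "nowhere_dense B \<Longrightarrow> A \<subseteq> B \<Longrightarrow> nowhere_dense A"
  unfolding nowhere_dense_def
  using interior_mono[OF closure_mono[of A B]] by blast

lemma meager_if_subset_UN:
  fixes F :: "nat \<Rightarrow> 'a::topological_space set"
  assumes "S \<subseteq> (\<Union>k. F k)" and "\<And>k. nowhere_dense (F k)"
  shows "meager S"
  unfolding meager_def
proof (intro exI conjI)
  \<comment> \<open>\<open>meager\<close> asks for equality with the union, hence the cut with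
    \<open>S\<close>.\<close>
  show "countable (range (\<lambda>k. S \<inter> F k))" by simp
  show "\<forall>A\<in>range (\<lambda>k. S \<inter> F k). nowhere_dense A"
    using assms(2) nowhere_dense_subset by blast
  show "S = \<Union> (range (\<lambda>k. S \<inter> F k))" using assms(1) by auto
qed

lemma basic_sequence_prod_ge:
  assumes "basic_sequence Q"
  shows "2 ^ n \<le> (\<Prod>j=1..n. Q j)"
proof -
  have "(\<Prod>j=1..n. 2) \<le> (\<Prod>j=1..n. Q j)"
    using assms by (intro prod_mono) (auto simp: basic_sequence_def)
  then show ?thesis by simp
qed

text \<open>For \<open>n \<le> j\<close> the n-th product divides the j-th, so the grid point
  contributes an integer, which \<open>frac\<close> discards. What remains is the j-th product times
  \<open>t\<close>, which lies in [0,1) and is its own fractional part.\<close>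

lemma T_map_right_of_grid_point:
  assumes Q: "basic_sequence Q" and "n \<le> j"
    and "0 \<le> t" and t: "of_int (\<Prod>i=1..j. Q i) * t < c" and "c \<le> 1"
  shows "T_map Q j (of_int m / of_int (\<Prod>i=1..n. Q i) + t) < c"
proof -
  let ?P = "\<lambda>k. \<Prod>i=1..k. Q i"
  have pos: "0 < ?P k" for k
    using basic_sequence_prod_ge[OF Q, of k] by (rule less_le_trans[rotated]) simp
  have "?P n dvd ?P j" using \<open>n \<le> j\<close> by (intro prod_dvd_prod_subset) auto
  then obtain r where r: "?P j = ?P n * r" by blast
  have "of_int (?P j) * (of_int m / of_int (?P n) + t) = of_int (?P j) * t + real_of_int (r * m)"
    unfolding r using pos[of n] by (simp add: field_simps del: of_int_prod prod_zero_iff)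
  moreover have "frac (of_int (?P j) * t) = of_int (?P j) * t"
    using pos[of j] \<open>0 \<le> t\<close> t \<open>c \<le> 1\<close> by (subst frac_eq) (simp del: of_int_prod)
  ultimately show ?thesis
    unfolding T_map_def using t by (simp add: frac_def del: of_int_mult of_int_prod)
qed

text \<open>The grid of level \<open>n\<close> has mesh at most \<open>1 / 2 ^ n\<close>, which is
  below \<open>b - a\<close> for large \<open>n\<close>; the first grid point to the right of
  \<open>a\<close> then lies before \<open>b\<close>.\<close>

lemma grid_point_in_interval:
  assumes Q: "basic_sequence Q" and "a < b"
  obtains n m where "a < of_int m / of_int (\<Prod>i=1..n. Q i)"
    and "of_int m / of_int (\<Prod>i=1..n. Q i) < (b::real)"
proof -
  obtain n where n: "1 / (b - a) < 2 ^ n" using real_arch_pow[of 2 "1 / (b - a)"] by auto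
  define p where "p = real_of_int (\<Prod>i=1..n. Q i)"
  \<comment> \<open>Floor plus one, not the ceiling: \<open>a\<close> may itself be a grid point,
    and the inequality must be strict.\<close>
  define m where "m = \<lfloor>a * p\<rfloor> + 1"
  have "real_of_int (2 ^ n) \<le> p"
    unfolding p_def of_int_le_iff by (rule basic_sequence_prod_ge[OF Q])
  then have "2 ^ n \<le> p" by simp
  then have p: "0 < p" "1 / (b - a) < p" using n by (auto intro: less_le_trans[of _ "2 ^ n"])
  then have "a * p + 1 < b * p" using \<open>a < b\<close> by (simp add: field_simps)
  moreover have "a * p < of_int m" "of_int m \<le> a * p + 1" unfolding m_def by linarith+
  ultimately have "a < of_int m / p" "of_int m / p < b"
    using p(1) by (auto simp: field_simps)
  then show thesis using that unfolding p_def by blast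
qed

text \<open>The constant 3/4 lies between the limit frequency 1/2 on \<open>DN Q\<close> and the
  frequencies near 1 found just to the right of grid points.\<close>

lemma nowhere_dense_half_frequency_le:
  assumes Q: "basic_sequence Q"
  shows "nowhere_dense {x. \<forall>N\<ge>K. real (card {n. n < N \<and> T_map Q n x < 1/2}) \<le> 3/4 * real N}"
    (is "nowhere_dense ?F")
proof (rule nowhere_denseI)
  fix U :: "real set"
  assume U: "open U" "U \<noteq> {}"
  then obtain x e where xe: "0 < e" "ball x e \<subseteq> U" by (meson ex_in_conv openE)
  obtain n m where y: "x - e < of_int m / of_int (\<Prod>i=1..n. Q i)"
      "of_int m / of_int (\<Prod>i=1..n. Q i) < x + e"
  proof (rule grid_point_in_interval[OF Q])
    show "x - e < x + e" using \<open>0 < e\<close> by simp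
  qed
  define y where "y = real_of_int m / of_int (\<Prod>i=1..n. Q i)"
  \<comment> \<open>Chosen so that \<open>K \<le> N\<close> and \<open>N - n > 3/4 * N\<close>: the
    times from \<open>n\<close> to \<open>N - 1\<close> alone break the bound. The summand 1 keeps
    this strict when \<open>K = 0\<close>.\<close>
  define N where "N = K + 4 * n + 1"
  have "K \<le> N" by (simp add: N_def)
  define p where "p j = real_of_int (\<Prod>i=1..j. Q i)" for j
  have p_ge_1: "1 \<le> p j" for j
    using basic_sequence_prod_ge[OF Q, of j] one_le_power[of "2::int" j]
    unfolding p_def by linarith
  \<comment> \<open>A common upper bound for all \<open>p j\<close> with \<open>j < N\<close>, as
    the summands are positive.\<close>
  define s where "s = (\<Sum>j<N. p j)"
  have p_le_s: "p j \<le> s" if "j < N" for j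
    unfolding s_def using that p_ge_1 by (intro member_le_sum) (auto intro: order_trans[of 0 1])
  have "1 \<le> s" using p_le_s[of 0] p_ge_1[of 0] by (simp add: N_def)
  \<comment> \<open>A displacement \<open>t < 1 / (2 * s)\<close> from \<open>y\<close> gives
    \<open>p j * t < 1/2\<close> for every \<open>j < N\<close>.\<close>
  define V where "V = {y<..<min (x + e) (y + 1 / (2 * s))}"
  have "x - e < y" "y < x + e" using y unfolding y_def by simp_all
  have "V \<inter> ?F = {}"
  proof (rule ccontr)
    assume "V \<inter> ?F \<noteq> {}"
    then obtain z where z: "z \<in> V" "z \<in> ?F" by blast
    define t where "t = z - y"
    have t: "0 < t" "t < 1 / (2 * s)" using z by (auto simp: V_def t_def)
    have "T_map Q j z < 1/2" if "n \<le> j" "j < N" for j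
    proof -
      have "p j * t \<le> s * t" using p_le_s[OF that(2)] t by simp
      also have "\<dots> < 1/2" using t \<open>1 \<le> s\<close> by (simp add: field_simps)
      finally show ?thesis
        using T_map_right_of_grid_point[OF Q that(1), of t "1/2" m] t
        by (simp add: p_def y_def t_def)
    qed
    then have "{n..<N} \<subseteq> {j. j < N \<and> T_map Q j z < 1/2}" by auto
    then have "card {n..<N} \<le> card {j. j < N \<and> T_map Q j z < 1/2}"
      by (intro card_mono) auto
    moreover have "real (card {j. j < N \<and> T_map Q j z < 1/2}) \<le> 3/4 * real N"
      using z(2) \<open>K \<le> N\<close> by blast
    ultimately have "real (N - n) \<le> 3/4 * real N" by simp
    then show False by (simp add: N_def)
  qed
  moreover have "open V" by (simp add: V_def)
  moreover have "V \<noteq> {}" using \<open>y < x + e\<close> \<open>1 \<le> s\<close> by (simp add: V_def not_le)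
  moreover have "V \<subseteq> U"
    using xe \<open>x - e < y\<close> by (auto simp: V_def ball_eq_greaterThanLessThan)
  ultimately show "\<exists>V. open V \<and> V \<noteq> {} \<and> V \<subseteq> U \<and> V \<inter> ?F = {}" by blast
qed

theorem theorem2p6:
  fixes Q :: "nat \<Rightarrow> int"
  assumes "basic_sequence Q"
  shows "meager (DN Q)"
proof (rule meager_if_subset_UN)
  let ?F = "\<lambda>K. {x. \<forall>N\<ge>K. real (card {n. n < N \<and> T_map Q n x < 1/2}) \<le> 3/4 * real N}"
  show "nowhere_dense (?F K)" for K using assms by (rule nowhere_dense_half_frequency_le)
  show "DN Q \<subseteq> (\<Union>K. ?F K)"
  proof
    fix x assume "x \<in> DN Q"
    then have "(\<lambda>N. real (card {n. n < N \<and> frac (T_map Q n x) \<in> {0..<1/2}}) / real N)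
        \<longlonglongrightarrow> 1/2 - 0"
      unfolding DN_def uniformly_distributed_mod1_def mem_Collect_eq
      by (elim allE[of _ 0] allE[of _ "1/2"]) simp
    \<comment> \<open>\<open>T_map\<close> is already a fractional part, so the outer
      \<open>frac\<close> is the identity and the lower bound 0 is automatic.\<close>
    moreover have "frac (T_map Q n x) \<in> {0..<1/2} \<longleftrightarrow> T_map Q n x < 1/2" for n
      by (simp add: T_map_def)
    ultimately have "(\<lambda>N. real (card {n. n < N \<and> T_map Q n x < 1/2}) / real N) \<longlonglongrightarrow> 1/2"
      by simp
    then have "\<forall>\<^sub>F N in sequentially. real (card {n. n < N \<and> T_map Q n x < 1/2}) / real N < 3/4"
      by (rule order_tendstoD) simp
    then obtain K where K: "\<And>N. K \<le> N \<Longrightarrow>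
        real (card {n. n < N \<and> T_map Q n x < 1/2}) / real N < 3/4"
      unfolding eventually_sequentially by blast
    \<comment> \<open>For \<open>N = 0\<close> the quotient is 0 by convention, and both sides here
      vanish.\<close>
    have "real (card {n. n < N \<and> T_map Q n x < 1/2}) \<le> 3/4 * real N" if "K \<le> N" for N
      using K[OF that] by (cases "N = 0") (simp_all add: field_simps)
    then show "x \<in> (\<Union>K. ?F K)" by blast
  qed
qed

end
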